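(* Let $t\geq 3$ and $n\geq 2$ be integers with $(t,n)\neq(3,2)$. Then there exists a balanced $t$-coloring of $C_t^n$ that contains no rainbow geometric line.
   Context: For positive integers $t,n$, $C_t^n=\{x_1x_2\cdots x_n : x_i\in\{0,1,\dots,t-1\}\}$ is the set of ordered $n$-tuples over the alphabet $\{0,\dots,t-1\}$. A geometric line in $C_t^n$ is a sequence of $t$ distinct points $\mathbf{x}_0,\mathbf{x}_1,\dots,\mathbf{x}_{t-1}$, $\mathbf{x}_i=x_{i1}x_{i2}\cdots x_{in}$, such that for each coordinate $j\in\{1,\dots,n\}$ one of the following holds: (1) $x_{0j}=x_{1j}=\cdots=x_{t-1,j}$; (2) $x_{ij}=i$ for every $0\le i\le t-1$; (3) $x_{ij}=t-1-i$ for every $0\le i\le t-1$. A $k$-coloring of $C_t^n$ is a surjective map $f:C_t^n\to\{0,\dots,k-1\}$; it is balanced if all color classes $f^{-1}(s)$ have the same cardinality. A geometric line is rainbow if its $t$ points receive pairwise distinct colors. *)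

theory Defs
  imports "HOL-Library.FuncSet"
begin

definition cube :: "nat \<Rightarrow> nat \<Rightarrow> (nat \<Rightarrow> nat) set" where
  "cube t n = {1..n} \<rightarrow>\<^sub>E {0..<t}"

(* A sequence of t points is a function on the naturals of which only the values at 0, ..., t - 1
   matter; x i j is the j-th coordinate of the i-th point. *)
definition geometric_line :: "nat \<Rightarrow> nat \<Rightarrow> (nat \<Rightarrow> nat \<Rightarrow> nat) \<Rightarrow> bool" where
  "geometric_line t n x \<longleftrightarrow>
     (\<forall>i\<in>{0..<t}. x i \<in> cube t n) \<and>
     inj_on x {0..<t} \<and>
     (\<forall>j\<in>{1..n}.
        (\<forall>i\<in>{0..<t}. x i j = x 0 j) \<or>
        (\<forall>i\<in>{0..<t}. x i j = i) \<or>
        (\<forall>i\<in>{0..<t}. x i j = t - 1 - i))"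

definition coloring :: "nat \<Rightarrow> nat \<Rightarrow> nat \<Rightarrow> ((nat \<Rightarrow> nat) \<Rightarrow> nat) \<Rightarrow> bool" where
  "coloring k t n f \<longleftrightarrow> f ` cube t n = {0..<k}"

definition color_class :: "nat \<Rightarrow> nat \<Rightarrow> ((nat \<Rightarrow> nat) \<Rightarrow> nat) \<Rightarrow> nat \<Rightarrow> (nat \<Rightarrow> nat) set" where
  "color_class t n f s = {p \<in> cube t n. f p = s}"

definition balanced :: "nat \<Rightarrow> nat \<Rightarrow> nat \<Rightarrow> ((nat \<Rightarrow> nat) \<Rightarrow> nat) \<Rightarrow> bool" where
  "balanced k t n f \<longleftrightarrow>
     (\<forall>r\<in>{0..<k}. \<forall>s\<in>{0..<k}. card (color_class t n f r) = card (color_class t n f s))"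

definition rainbow :: "nat \<Rightarrow> ((nat \<Rightarrow> nat) \<Rightarrow> nat) \<Rightarrow> (nat \<Rightarrow> nat \<Rightarrow> nat) \<Rightarrow> bool" where
  "rainbow t f x \<longleftrightarrow> (\<forall>i\<in>{0..<t}. \<forall>j\<in>{0..<t}. i \<noteq> j \<longrightarrow> f (x i) \<noteq> f (x j))"

end

theory Submission
  imports Defs
begin

text \<open>
  A coloring without rainbow lines pulls back along the projection that forgets the last
  coordinate: the image of a line is again a line or a single point. Hence it suffices to treat
  dimension 2 for \<open>t \<ge> 4\<close>, and dimension 3 for \<open>t = 3\<close>. In dimension 2, start from the coloring by
  the row index and recolor rows 0 and 1, as far as parity permits, by 0 on the left half and by
  1 on the right half. Then every column and both diagonals repeat a color within these two rows,
  except for the middle column when \<open>t\<close> is odd; there, an exchange of one cell with row 2 creates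
  a repetition.
\<close>

section \<open>Balanced colorings without rainbow lines\<close>

text \<open>Prescribing the class size \<open>t ^ (n - 1)\<close> gives balance and, for
  \<open>t > 0\<close>, surjectivity as well, since no class is empty. It is also the form that
  carries over to the next dimension.\<close>

definition rainbow_free :: "nat \<Rightarrow> nat \<Rightarrow> ((nat \<Rightarrow> nat) \<Rightarrow> nat) \<Rightarrow> bool" where
  "rainbow_free t n f \<longleftrightarrow>
     f ` cube t n \<subseteq> {0..<t} \<and>
     (\<forall>s<t. card (color_class t n f s) = t ^ (n - 1)) \<and>
     \<not> (\<exists>x. geometric_line t n x \<and> rainbow t f x)"

lemma rainbow_free_imp_balanced_coloring:
  assumes "rainbow_free t n f" "t > 0"
  shows "coloring t t n f \<and> balanced t t n f \<and> \<not> (\<exists>x. geometric_line t n x \<and> rainbow t f x)"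
proof -
  have "s \<in> f ` cube t n" if "s < t" for s
  proof -
    have "card (color_class t n f s) > 0"
      using assms that by (simp add: rainbow_free_def)
    then have "color_class t n f s \<noteq> {}"
      by (metis card.empty less_irrefl)
    then show ?thesis
      by (auto simp: color_class_def)
  qed
  then show ?thesis
    using assms by (auto simp: rainbow_free_def coloring_def balanced_def)
qed

section \<open>Adding a coordinate\<close>

text \<open>A point of the larger cube amounts to its projection and its last coordinate, and the
  projection alone decides the color. So every class becomes a product with the alphabet, which
  gives its size.\<close>

lemma color_class_pullback:
  "color_class t (Suc n) (\<lambda>p. f (restrict p {1..n})) s =
   (\<lambda>(y, p). p(Suc n := y)) ` ({0..<t} \<times> color_class t n f s)"
proof -
  have restr: "restrict (p(Suc n := y)) {1..n} = p" if "p \<in> cube t n" for p y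
    using that by (auto simp: cube_def fun_eq_iff PiE_def extensional_def)
  have upd: "p(Suc n := y) \<in> cube t (Suc n)" if "p \<in> cube t n" "y < t" for p y
    using that by (auto simp: cube_def PiE_def extensional_def Pi_def)
  have "p = (\<lambda>(y, p). p(Suc n := y)) (p (Suc n), restrict p {1..n})"
    if "p \<in> cube t (Suc n)" for p
    using that by (auto simp: cube_def fun_eq_iff PiE_def extensional_def)
  moreover have "p (Suc n) < t" "restrict p {1..n} \<in> cube t n" if "p \<in> cube t (Suc n)" for p
    using that by (auto simp: cube_def PiE_def Pi_def)
  ultimately have "p \<in> (\<lambda>(y, p). p(Suc n := y)) ` ({0..<t} \<times> color_class t n f s)"
    if "p \<in> cube t (Suc n)" "f (restrict p {1..n}) = s" for p
    using that by (intro image_eqI[of _ _ "(p (Suc n), restrict p {1..n})"])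
      (auto simp: color_class_def)
  then show ?thesis
    using restr upd by (auto simp: color_class_def)
qed

lemma rainbow_free_Suc:
  assumes f: "rainbow_free t n f" and "n > 0" "t \<ge> 2"
  shows "rainbow_free t (Suc n) (\<lambda>p. f (restrict p {1..n}))"
proof -
  let ?f = "\<lambda>p. f (restrict p {1..n})"
  have restr: "restrict p {1..n} \<in> cube t n" if "p \<in> cube t (Suc n)" for p
    using that by (auto simp: cube_def PiE_def Pi_def)
  have "inj_on (\<lambda>(y, p). p(Suc n := y)) ({0..<t} \<times> color_class t n f s)" for s
  proof (rule inj_onI, clarify)
    fix y p z q
    assume p: "p \<in> color_class t n f s" "q \<in> color_class t n f s"
      and eq: "p(Suc n := y) = q(Suc n := z)"
    \<comment> \<open>At \<open>Suc n\<close> the updates hide the old values, but all points of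
      \<open>cube t n\<close> are \<open>undefined\<close> there.\<close>
    have "p k = q k" for k
    proof (cases "k = Suc n")
      case True
      then show ?thesis
        using p by (auto simp: color_class_def cube_def PiE_def extensional_def)
    next
      case False
      then show ?thesis
        using fun_cong[OF eq, of k] by simp
    qed
    then show "y = z \<and> p = q"
      using fun_cong[OF eq, of "Suc n"] by auto
  qed
  then have "card (color_class t (Suc n) ?f s) = t * card (color_class t n f s)" for s
    by (simp only: color_class_pullback card_image card_cartesian_product) simp
  \<comment> \<open>With truncated subtraction, \<open>t * t ^ (n - 1) = t ^ n\<close> relies on
    \<open>n > 0\<close>.\<close>
  then have "card (color_class t (Suc n) ?f s) = t ^ (Suc n - 1)" if "s < t" for s
    using f that \<open>n > 0\<close> by (simp add: rainbow_free_def flip: power_Suc)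
  moreover have "\<not> rainbow t ?f x" if x: "geometric_line t (Suc n) x" for x
  proof
    assume rb: "rainbow t ?f x"
    \<comment> \<open>A line moving only in the last coordinate projects to a single point. Distinct
      colors rule this out, because they force distinct projections.\<close>
    have "inj_on (\<lambda>i. restrict (x i) {1..n}) {0..<t}"
      using rb unfolding rainbow_def inj_on_def by metis
    then have "geometric_line t n (\<lambda>i. restrict (x i) {1..n})"
      using x restr by (auto simp: geometric_line_def)
    then show False
      using f rb by (auto simp: rainbow_free_def rainbow_def)
  qed
  moreover have "?f ` cube t (Suc n) \<subseteq> {0..<t}"
    using f restr by (auto simp: rainbow_free_def)
  ultimately show ?thesis
    unfolding rainbow_free_def by blast
qed

lemma rainbow_free_mono:
  assumes "rainbow_free t m f" "m > 0" "t \<ge> 2" "m \<le> n"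
  shows "\<exists>g. rainbow_free t n g"
  using \<open>m \<le> n\<close>
proof (induction n rule: dec_induct)
  case base
  then show ?case
    using assms by blast
next
  case (step n)
  then show ?case
    using rainbow_free_Suc[of t n] assms by force
qed

section \<open>Lines and colorings in the square\<close>

text \<open>That some coordinate moves is implicit in the distinctness of the points: extensional
  functions that agree on \<open>{1..n}\<close> are equal.\<close>

lemma geometric_line_nonconstant:
  assumes "geometric_line t n x" "t \<ge> 2"
  shows "\<exists>j\<in>{1..n}. x 0 j \<noteq> x 1 j"
proof (rule ccontr)
  assume "\<not> ?thesis"
  moreover have "x 0 \<in> cube t n" "x 1 \<in> cube t n"
    using assms by (auto simp: geometric_line_def)
  ultimately have "x 0 = x 1"
    unfolding cube_def by (intro PiE_ext[of "x 0" _ _ "x 1"]) auto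
  moreover have "x 0 \<noteq> x 1"
    using assms inj_onD[of x "{0..<t}" 0 1] by (auto simp: geometric_line_def)
  ultimately show False
    by blast
qed

text \<open>Up to reversal, the lines of the square are the rows, the columns and the two diagonals.
  Each of the last four assumptions supplies a repeated color on one of these kinds.\<close>

lemma rainbow_free_square:
  assumes t: "t \<ge> 2"
    and range: "\<And>a b. a < t \<Longrightarrow> b < t \<Longrightarrow> g a b < t"
    and card: "\<And>s. s < t \<Longrightarrow> card {(a, b). a < t \<and> b < t \<and> g a b = s} = t"
    and row: "\<And>a. a < t \<Longrightarrow> \<exists>b<t. \<exists>c<t. b \<noteq> c \<and> g a b = g a c"
    and col: "\<And>b. b < t \<Longrightarrow> \<exists>a<t. \<exists>c<t. a \<noteq> c \<and> g a b = g c b"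
    and diag: "g 0 0 = g 1 1" and anti: "g 0 (t - 1) = g 1 (t - 2)"
  shows "rainbow_free t 2 (\<lambda>p. g (p 1) (p 2))"
proof -
  let ?f = "\<lambda>p :: nat \<Rightarrow> nat. g (p 1) (p 2)"
  \<comment> \<open>The inverse of reading off both coordinates; the value \<open>undefined\<close>
    elsewhere makes the result extensional.\<close>
  let ?p = "\<lambda>(a, b) k. if k = (1 :: nat) then a else if k = 2 then b else (undefined :: nat)"
  have two: "{1..2} = {1, 2 :: nat}"
    by auto
  have "?p (p 1, p 2) = p" if "p \<in> cube t 2" for p
    using PiE_arb[OF that[unfolded cube_def two]] by (intro ext) auto
  moreover have "?p (a, b) \<in> cube t 2" if "a < t" "b < t" for a b
    using that unfolding cube_def two by (intro PiE_I) auto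
  moreover have "p 1 < t" "p 2 < t" if "p \<in> cube t 2" for p
    using PiE_mem[OF that[unfolded cube_def two]] by auto
  ultimately have bij: "bij_betw (\<lambda>p. (p 1, p 2)) (color_class t 2 ?f s)
      {(a, b). a < t \<and> b < t \<and> g a b = s}" for s
    by (intro bij_betwI[where g = ?p]) (auto simp: color_class_def)
  have "card (color_class t 2 ?f s) = t ^ (2 - 1)" if "s < t" for s
    using bij_betw_same_card[OF bij] card[OF that] by simp
  moreover have "?f ` cube t 2 \<subseteq> {0..<t}"
    using range by (auto simp: cube_def PiE_def Pi_def)
  moreover have "\<not> rainbow t ?f x" if x: "geometric_line t 2 x" for x
  proof
    assume rb: "rainbow t ?f x"
    have rbD: "g (x i 1) (x i 2) \<noteq> g (x k 1) (x k 2)" if "i < t" "k < t" "i \<noteq> k" for i k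
      using rb that by (auto simp: rainbow_def)
    have bound: "x 0 j < t" if "j \<in> {1, 2}" for j
      using x that t by (auto simp: geometric_line_def cube_def two PiE_def Pi_def)
    have pattern: "(\<exists>v<t. \<forall>i<t. x i j = v) \<or> (\<forall>i<t. x i j = i) \<or> (\<forall>i<t. x i j = t - 1 - i)"
      if "j \<in> {1, 2}" for j
      using x that bound[OF that]
      unfolding geometric_line_def two atLeast0LessThan Ball_def lessThan_iff by blast
    have nonconst: "\<not> ((\<exists>v<t. \<forall>i<t. x i 1 = v) \<and> (\<exists>v<t. \<forall>i<t. x i 2 = v))"
      using geometric_line_nonconstant[OF x t, unfolded two] t by fastforce
    \<comment> \<open>A diagonal run through backwards meets rows 1 and 0 at its last two indices
      \<open>t - 2\<close> and \<open>t - 1\<close>.\<close>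
    have rev: "t - 1 \<noteq> t - 2" "t - 1 - (t - 2) = 1"
      using t by auto
    consider (row) "\<exists>v<t. \<forall>i<t. x i 1 = v" | (col) "\<exists>v<t. \<forall>i<t. x i 2 = v"
      | (ii) "\<forall>i<t. x i 1 = i" "\<forall>i<t. x i 2 = i"
      | (ir) "\<forall>i<t. x i 1 = i" "\<forall>i<t. x i 2 = t - 1 - i"
      | (ri) "\<forall>i<t. x i 1 = t - 1 - i" "\<forall>i<t. x i 2 = i"
      | (rr) "\<forall>i<t. x i 1 = t - 1 - i" "\<forall>i<t. x i 2 = t - 1 - i"
      using pattern[of 1, OF insertI1] pattern[of 2, OF insertI2[OF singletonI]] by argo
    then show False
    proof cases
      case row
      then have "\<not> (\<exists>v<t. \<forall>i<t. x i 2 = v)"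
        using nonconst by blast
      then have "(\<forall>i<t. x i 2 = i) \<or> (\<forall>i<t. x i 2 = t - 1 - i)"
        using pattern[of 2, OF insertI2[OF singletonI]] by argo
      moreover obtain a where a: "a < t" "\<forall>i<t. x i 1 = a"
        using row by blast
      moreover obtain b c where "b < t" "c < t" "b \<noteq> c" "g a b = g a c"
        using assms(4)[OF a(1)] by blast
      \<comment> \<open>If the row is run through backwards, columns \<open>b\<close> and
        \<open>c\<close> are met at these indices.\<close>
      moreover from this have "t - 1 - b \<noteq> t - 1 - c"
        by linarith
      ultimately show False
        using rbD[of b c] rbD[of "t - 1 - b" "t - 1 - c"] by auto
    next
      case col
      then have "\<not> (\<exists>v<t. \<forall>i<t. x i 1 = v)"
        using nonconst by blast
      then have "(\<forall>i<t. x i 1 = i) \<or> (\<forall>i<t. x i 1 = t - 1 - i)"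
        using pattern[of 1, OF insertI1] by argo
      moreover obtain b where b: "b < t" "\<forall>i<t. x i 2 = b"
        using col by blast
      moreover obtain a c where "a < t" "c < t" "a \<noteq> c" "g a b = g c b"
        using assms(5)[OF b(1)] by blast
      moreover from this have "t - 1 - a \<noteq> t - 1 - c"
        by linarith
      ultimately show False
        using rbD[of a c] rbD[of "t - 1 - a" "t - 1 - c"] by auto
    next
      case ii
      then show False
        using rbD[of 0 1] diag t by auto
    next
      case ir
      then show False
        using rbD[of 0 1] anti t by (auto simp: numeral_2_eq_2)
    next
      case ri
      then show False
        using rbD[of "t - 1" "t - 2"] rev anti t by simp
    next
      case rr
      then show False
        using rbD[of "t - 1" "t - 2"] rev diag t by simp
    qed
  qed
  ultimately show ?thesis
    unfolding rainbow_free_def by blast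
qed

lemma rainbow_free_square_even:
  assumes m: "m \<ge> 2"
  shows "\<exists>f. rainbow_free (2 * m) 2 f"
proof -
  define g :: "nat \<Rightarrow> nat \<Rightarrow> nat"
    where "g a b = (if a < 2 then if b < m then 0 else 1 else a)" for a b
  have "card {(a, b). a < 2 * m \<and> b < 2 * m \<and> g a b = s} = 2 * m" if "s < 2 * m" for s
  proof -
    have "{(a, b). a < 2 * m \<and> b < 2 * m \<and> g a b = s} =
      (if s = 0 then {0..<2} \<times> {0..<m} else if s = 1 then {0..<2} \<times> {m..<2 * m}
       else {s} \<times> {0..<2 * m})"
      using m that by (auto simp: g_def)
    then show ?thesis
      by simp
  qed
  \<comment> \<open>Columns 0 and 1 both lie in the left half because
    \<open>m \<ge> 2\<close>.\<close>
  moreover have "\<exists>b<2 * m. \<exists>c<2 * m. b \<noteq> c \<and> g a b = g a c" for a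
    using m by (intro exI[of _ 0] conjI exI[of _ 1]) (auto simp: g_def)
  moreover have "\<exists>a<2 * m. \<exists>c<2 * m. a \<noteq> c \<and> g a b = g c b" for b
    using m by (intro exI[of _ 0] conjI exI[of _ 1]) (auto simp: g_def)
  ultimately have "rainbow_free (2 * m) 2 (\<lambda>p. g (p 1) (p 2))"
    using m by (intro rainbow_free_square) (auto simp: g_def)
  then show ?thesis
    by blast
qed

lemma rainbow_free_square_odd:
  assumes m: "m \<ge> 2"
  shows "\<exists>f. rainbow_free (2 * m + 1) 2 f"
proof -
  let ?t = "2 * m + 1"
  \<comment> \<open>The term \<open>2 * a\<close> colors the middle cells of rows 0 and 1 by 0 and
    2. Color 2 thus gains \<open>(1, m)\<close>, and in return \<open>(2, 2 * m)\<close> passes to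
    color 1, so each class has \<open>2 * m + 1\<close> cells.\<close>
  define g :: "nat \<Rightarrow> nat \<Rightarrow> nat"
    where "g a b = (if a < 2 then if b < m then 0 else if b > m then 1 else 2 * a
                    else if a = 2 \<and> b = 2 * m then 1 else a)" for a b
  have "card {(a, b). a < ?t \<and> b < ?t \<and> g a b = s} = ?t" if "s < ?t" for s
  proof -
    have "{(a, b). a < ?t \<and> b < ?t \<and> g a b = s} =
      (if s = 0 then insert (0, m) ({0..<2} \<times> {0..<m})
       else if s = 1 then insert (2, 2 * m) ({0..<2} \<times> {m<..<?t})
       else if s = 2 then insert (1, m) ({2} \<times> {0..<2 * m})
       else {s} \<times> {0..<?t})"
      using m that by (auto simp: g_def split: if_splits)
    then show ?thesis
      by (simp add: card_insert_if)
  qed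
  moreover have "\<exists>b<?t. \<exists>c<?t. b \<noteq> c \<and> g a b = g a c" for a
    using m by (intro exI[of _ 0] conjI exI[of _ 1]) (auto simp: g_def)
  moreover have "\<exists>a<?t. \<exists>c<?t. a \<noteq> c \<and> g a b = g c b" for b
  proof (cases "b = m")
    case True
    \<comment> \<open>The exchanged cell \<open>(1, m)\<close> agrees with \<open>(2, m)\<close>,
      which keeps color 2 because \<open>m < 2 * m\<close>.\<close>
    then show ?thesis
      using m by (intro exI[of _ 1] conjI exI[of _ 2]) (auto simp: g_def)
  next
    case False
    then show ?thesis
      using m by (intro exI[of _ 0] conjI exI[of _ 1]) (auto simp: g_def)
  qed
  ultimately have "rainbow_free ?t 2 (\<lambda>p. g (p 1) (p 2))"
    using m by (intro rainbow_free_square) (auto simp: g_def)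
  then show ?thesis
    by blast
qed

section \<open>The cube of side 3 in dimension three\<close>

text \<open>Found by computer search.\<close>

definition cube3_color :: "nat \<Rightarrow> nat \<Rightarrow> nat \<Rightarrow> nat" where
  "cube3_color a b c =
     (if b = 1 then [0, 1, 0] else if a \<noteq> 1 then [2, 2, 1]
      else if b = 0 then [0, 1, 1] else [0, 2, 0]) ! c"

text \<open>The value sequences one coordinate can take along a line for \<open>t = 3\<close>; every
  line is then a triple of patterns, which leaves 125 cases.\<close>

definition line_patterns :: "nat list list" where
  "line_patterns = [[0, 0, 0], [1, 1, 1], [2, 2, 2], [0, 1, 2], [2, 1, 0]]"

text \<open>A finite check over all triples of patterns. The first alternative sets aside the
  triples with no moving coordinate, since a moving pattern already differs at positions 0 and
  1.\<close>

lemma cube3_color_not_rainbow: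
  "\<forall>u\<in>set line_patterns. \<forall>v\<in>set line_patterns. \<forall>w\<in>set line_patterns.
     u ! 0 = u ! 1 \<and> v ! 0 = v ! 1 \<and> w ! 0 = w ! 1 \<or>
     \<not> distinct (map (\<lambda>i. cube3_color (u ! i) (v ! i) (w ! i)) [0, 1, 2])"
  by code_simp

lemma cube3_color_less:
  "\<forall>a\<in>set [0, 1, 2]. \<forall>b\<in>set [0, 1, 2]. \<forall>c\<in>set [0, 1, 2]. cube3_color a b c < 3"
  by code_simp

text \<open>Stating the class size \<open>3 ^ 2\<close> as a list length allows evaluation;
  distinctness of the product list later turns it into a cardinality.\<close>

lemma cube3_color_count:
  "\<forall>s\<in>set [0, 1, 2]. length (filter (\<lambda>(a, b, c). cube3_color a b c = s)
     (List.product [0, 1, 2] (List.product [0, 1, 2] [0, 1, 2]))) = 9"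
  by code_simp

lemma rainbow_free_cube3: "rainbow_free 3 3 (\<lambda>p. cube3_color (p 1) (p 2) (p 3))"
proof -
  let ?f = "\<lambda>p :: nat \<Rightarrow> nat. cube3_color (p 1) (p 2) (p 3)"
  \<comment> \<open>Kept folded, since the simplifier would expand the product lists below.\<close>
  define T :: "nat list" where "T = [0, 1, 2]"
  have T: "set T = {0, 1, 2}" "distinct T"
    by (simp_all add: T_def)
  have three: "{1..3} = {1, 2, 3 :: nat}" "{0..<3} = {0, 1, 2 :: nat}"
    by auto
  let ?p = "\<lambda>(a, b, c) k. if k = (1 :: nat) then a else if k = 2 then b else if k = 3 then c
      else (undefined :: nat)"
  have inv: "?p (p 1, p 2, p 3) = p" if "p \<in> cube 3 3" for p
    using PiE_arb[OF that[unfolded cube_def three]] by (intro ext) auto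
  have mem: "?p (a, b, c) \<in> cube 3 3" if "{a, b, c} \<subseteq> set T" for a b c
    using that T unfolding cube_def three by (intro PiE_I) auto
  have coords: "{p 1, p 2, p 3} \<subseteq> set T" if "p \<in> cube 3 3" for p
    using PiE_mem[OF that[unfolded cube_def three]] by (auto simp: T)
  have "card (color_class 3 3 ?f s) = 3 ^ (3 - 1)" if "s < 3" for s
  proof -
    let ?L = "filter (\<lambda>(a, b, c). cube3_color a b c = s)
     (List.product T (List.product T T))"
    have "bij_betw (\<lambda>p. (p 1, p 2, p 3)) (color_class 3 3 ?f s) (set ?L)"
    proof (rule bij_betwI[where g = ?p])
      show "(\<lambda>p. (p 1, p 2, p 3)) \<in> color_class 3 3 ?f s \<rightarrow> set ?L"
      proof (rule Pi_I)
        fix p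
        assume p: "p \<in> color_class 3 3 ?f s"
        then have "p \<in> cube 3 3"
          by (simp add: color_class_def)
        from coords[OF this] show "(p 1, p 2, p 3) \<in> set ?L"
          using p by (simp add: color_class_def)
      qed
      show "?p \<in> set ?L \<rightarrow> color_class 3 3 ?f s"
      proof (rule Pi_I)
        fix q
        assume "q \<in> set ?L"
        moreover obtain a b c where q: "q = (a, b, c)"
          by (rule prod_cases3)
        ultimately have abc: "(a, b, c) \<in> set ?L"
          by (simp only:)
        then have "?p (a, b, c) \<in> cube 3 3"
          by (intro mem) simp
        moreover have "?f (?p (a, b, c)) = s"
          using abc by simp
        ultimately show "?p q \<in> color_class 3 3 ?f s"
          by (simp only: q color_class_def mem_Collect_eq simp_thms)
      qed
      show "?p (p 1, p 2, p 3) = p" if "p \<in> color_class 3 3 ?f s" for p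
        using that inv by (simp only: color_class_def mem_Collect_eq)
      show "(?p q 1, ?p q 2, ?p q 3) = q" for q
        by (cases q) simp
    qed
    then have "card (color_class 3 3 ?f s) = card (set ?L)"
      by (rule bij_betw_same_card)
    also have "\<dots> = length ?L"
      by (intro distinct_card distinct_filter distinct_product T)
    also have "\<dots> = 9"
    proof -
      have "s \<in> set T"
        using that by (auto simp: T)
      then show ?thesis
        using cube3_color_count[folded T_def] by blast
    qed
    finally show ?thesis
      by simp
  qed
  moreover have "?f ` cube 3 3 \<subseteq> {0..<3}"
  proof (rule image_subsetI)
    fix p
    assume "p \<in> cube 3 3"
    from coords[OF this] show "?f p \<in> {0..<3}"
      using cube3_color_less[folded T_def] by simp
  qed
  moreover have "\<not> rainbow 3 ?f x" if x: "geometric_line 3 3 x" for x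
  proof
    assume rb: "rainbow 3 ?f x"
    have "map (\<lambda>i. x i j) [0, 1, 2] \<in> set line_patterns" if "j \<in> {1, 2, 3}" for j
    proof -
      have "x 0 \<in> cube 3 3"
        using x by (simp add: geometric_line_def)
      then have "x 0 j \<in> {0, 1, 2}"
        unfolding cube_def three using that by (rule PiE_mem)
      moreover have "x 1 j = x 0 j \<and> x 2 j = x 0 j \<or> x 0 j = 0 \<and> x 1 j = 1 \<and> x 2 j = 2 \<or>
          x 0 j = 2 \<and> x 1 j = 1 \<and> x 2 j = 0"
        using bspec[OF x[unfolded geometric_line_def three, THEN conjunct2, THEN conjunct2] that]
        by auto
      ultimately show ?thesis
        by (auto simp: line_patterns_def)
    qed
    \<comment> \<open>This excludes the alternative of three constant patterns in the finite
      check.\<close>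
    moreover have "\<exists>j\<in>{1, 2, 3}. x 0 j \<noteq> x 1 j"
      using geometric_line_nonconstant[OF x] by (simp add: three(1)[simplified])
    ultimately have "\<not> distinct (map (\<lambda>i. ?f (x i)) [0, 1, 2])"
      using cube3_color_not_rainbow[rule_format, of "map (\<lambda>i. x i 1) [0, 1, 2]"
          "map (\<lambda>i. x i 2) [0, 1, 2]" "map (\<lambda>i. x i 3) [0, 1, 2]"]
      by auto
    then show False
      using rb unfolding rainbow_def three by auto
  qed
  ultimately show ?thesis
    unfolding rainbow_free_def by blast
qed

section \<open>Combining the base cases\<close>

theorem theorem2:
  fixes t n :: nat
  assumes "t \<ge> 3" and "n \<ge> 2" and "(t, n) \<noteq> (3, 2)"
  shows "\<exists>f. coloring t t n f \<and> balanced t t n f \<and>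
             \<not> (\<exists>x. geometric_line t n x \<and> rainbow t f x)"
proof -
  have "\<exists>f. rainbow_free t n f"
  proof (cases "t = 3")
    case True
    \<comment> \<open>The excluded pair leaves \<open>n \<ge> 3\<close>, so dimension 3 can serve as
      the base.\<close>
    then show ?thesis
      using assms rainbow_free_mono[OF rainbow_free_cube3, of n] by simp
  next
    case False
    \<comment> \<open>Now \<open>t \<ge> 4\<close>, which provides the bound on \<open>m\<close> in
      both square constructions.\<close>
    then have m: "t div 2 \<ge> 2"
      using assms by linarith
    have "t = 2 * (t div 2) \<or> t = 2 * (t div 2) + 1"
      by linarith
    then have "\<exists>f. rainbow_free t 2 f"
      using rainbow_free_square_even[OF m] rainbow_free_square_odd[OF m] by metis
    then show ?thesis
      using assms rainbow_free_mono[of t 2] by auto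
  qed
  then show ?thesis
    using rainbow_free_imp_balanced_coloring assms by fastforce
qed

end
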